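(* Let $n$ be a positive integer. (1) If $x,y\in B^n$ are arbitrary and $w=|x-y|\,e_1/2$, then $$k_{B^n}(x,y)\ge k_{B^n}(-w,w)=2\,k_{B^n}(0,w)=2\log\frac{2}{2-|x-y|}\ge|x-y|,$$ where the first inequality becomes an equality when $y=-x$. Moreover, the identity map $\mathrm{id}:(B^n,k_{B^n})\to(B^n,|\cdot|)$ has the sharp modulus of continuity $\omega(t)=2(1-e^{-t/2})$; that is, $|x-y|\le\omega(k_{B^n}(x,y))$ for all $x,y\in B^n$, and for every $t\ge0$ there exist $x,y\in B^n$ with $k_{B^n}(x,y)=t$ and $|x-y|=\omega(t)$. (2) Let $G\subsetneq\mathbb{R}^n$ be a domain with $\operatorname{diam}G<\infty$ and let $r=\sqrt{n/(2n+2)}\,\operatorname{diam}G$. Then for all distinct $x,y\in G$, with $t=|x-y|/r$, $$k_G(x,y)\ge 2\log\frac{2}{2-t}\ge t,$$ with equality in the first step when $G=B^n(z,r)$ and $z=(x+y)/2$. Moreover, the identity map $\mathrm{id}:(G,k_G)\to(G,|\cdot|)$ has the sharp modulus of continuity $\omega(t)=2r(1-e^{-t/2})$; that is, $|x-y|\le\omega(k_G(x,y))$ for all $x,y\in G$, with equality when $G=B^n(z,r)$ and $z=(x+y)/2$.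
   Context: $B^n(z,r)$ is the open Euclidean ball in $\mathbb{R}^n$ with center $z$ and radius $r$, $B^n=B^n(0,1)$, $e_1$ is the first standard unit vector, $|\cdot|$ is the Euclidean norm and $\operatorname{diam}$ the Euclidean diameter. For a domain (open connected nonempty set) $G\subsetneq\mathbb{R}^n$, $\delta_G(x)$ is the Euclidean distance from $x\in G$ to $\partial G$. The quasihyperbolic metric of $G$ is $$k_G(x,y)=\inf_{\gamma}\int_\gamma\frac{|dz|}{\delta_G(z)},\qquad x,y\in G,$$ where the infimum is over all rectifiable paths $\gamma$ in $G$ joining $x$ and $y$. *)

theory Defs
  imports "HOL-Analysis.Analysis"
begin

text \<open>
  Rectifiable paths and integration with respect to arc length. Paths are parametrised
  over \<open>{0..1}\<close>, as in the library.
\<close>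

text \<open>Lengths of the polygonal chains inscribed in the restriction of \<open>\<gamma>\<close> to \<open>{0..t}\<close>.\<close>

definition inscribed_lengths :: "(real \<Rightarrow> 'a::metric_space) \<Rightarrow> real \<Rightarrow> real set" where
  "inscribed_lengths \<gamma> t =
     {\<Sum>i<m. dist (\<gamma> (d i)) (\<gamma> (d (Suc i))) | (m::nat) (d::nat \<Rightarrow> real).
        mono_on {..m} d \<and> d ` {..m} \<subseteq> {0..t}}"

definition rectifiable_path :: "(real \<Rightarrow> 'a::metric_space) \<Rightarrow> bool" where
  "rectifiable_path \<gamma> \<longleftrightarrow> path \<gamma> \<and> bdd_above (inscribed_lengths \<gamma> 1)"

definition length_up_to :: "(real \<Rightarrow> 'a::metric_space) \<Rightarrow> real \<Rightarrow> real" where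
  "length_up_to \<gamma> t = Sup (inscribed_lengths \<gamma> t)"

text \<open>
  For a rectifiable path, \<open>length_up_to \<gamma>\<close> maps \<open>{0..1}\<close> continuously and monotonically onto
  \<open>{0..length_up_to \<gamma> 1}\<close>, and \<open>\<gamma>\<close> is constant on its fibres. So the choice of the parameter
  \<open>t\<close> below does not matter, and \<open>arc_length_param \<gamma>\<close> is the unique map \<open>\<gamma>\<^sub>0\<close> on
  \<open>{0..length_up_to \<gamma> 1}\<close> with \<open>\<gamma> t = \<gamma>\<^sub>0 (length_up_to \<gamma> t)\<close> for all \<open>t\<close> in \<open>{0..1}\<close>.
\<close>

definition arc_length_param :: "(real \<Rightarrow> 'a::metric_space) \<Rightarrow> real \<Rightarrow> 'a" where
  "arc_length_param \<gamma> u = \<gamma> (SOME t. t \<in> {0..1} \<and> length_up_to \<gamma> t = u)"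

definition arc_length_integral :: "(real \<Rightarrow> 'a::metric_space) \<Rightarrow> ('a \<Rightarrow> real) \<Rightarrow> real" where
  "arc_length_integral \<gamma> \<rho> =
     integral {0..length_up_to \<gamma> 1} (\<lambda>u. \<rho> (arc_length_param \<gamma> u))"

definition proper_domain :: "'a::euclidean_space set \<Rightarrow> bool" where
  "proper_domain G \<longleftrightarrow> open G \<and> connected G \<and> G \<noteq> {} \<and> G \<noteq> UNIV"

definition boundary_dist :: "'a::euclidean_space set \<Rightarrow> 'a \<Rightarrow> real" where
  "boundary_dist G x = infdist x (frontier G)"

text \<open>
  In a proper domain the set below is nonempty and consists of nonnegative reals, and the
  integrands are continuous, so \<open>Inf\<close> and \<open>integral\<close> have their usual meaning.
\<close>

definition qh_metric :: "'a::euclidean_space set \<Rightarrow> 'a \<Rightarrow> 'a \<Rightarrow> real" where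
  "qh_metric G x y =
     Inf {arc_length_integral \<gamma> (\<lambda>z. 1 / boundary_dist G z) | \<gamma>.
            rectifiable_path \<gamma> \<and> path_image \<gamma> \<subseteq> G \<and> pathstart \<gamma> = x \<and> pathfinish \<gamma> = y}"

end

theory Submission
  imports Defs
begin

text \<open>
  A domain \<open>G\<close> contained in \<open>B(z,r)\<close> satisfies \<open>\<delta>\<^sub>G(x) \<le> r - |x - z|\<close>. Projecting a path onto
  the direction \<open>e\<close> of \<open>y - x\<close> therefore bounds its quasihyperbolic length from below by the
  integral of \<open>1 / (r - |s|)\<close> over an interval of length \<open>|x - y|\<close>; this is smallest when the
  interval is centred at 0, which gives \<open>2 log (2 / (2 - |x - y| / r))\<close>. The diameter segment
  attains the bound in a ball. For a bounded domain of diameter \<open>d\<close>, Jung's theorem provides such a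
  ball with \<open>r = \<surd>(n / (2n + 2)) d\<close>.
\<close>

section \<open>Rectifiable paths and arc length\<close>

text \<open>Both parts are one estimate for a domain inside some \<open>ball z r\<close>: the unit
  ball takes \<open>z = 0\<close> and \<open>r = 1\<close>, a bounded domain takes Jung's ball. The
  modulus is the inverse function of the logarithmic bound. The obstacle is regularity: the
  projection of an arc-length parametrisation is only 1-Lipschitz, so the potential along it need
  not be differentiable everywhere. It is compared with the integral on short subintervals instead,
  where the integrand is nearly constant. Jung's constant arises because the centre of the minimal
  ball is a convex combination of at most n + 1 contact points; n / (2n + 2) is half of 1 - 1 / (n +
  1).\<close>

lemma inscribed_lengthsI:
  assumes "mono_on {..m} d" "d ` {..m} \<subseteq> {0..t}"
  shows "(\<Sum>i<m. dist (\<gamma> (d i)) (\<gamma> (d (Suc i)))) \<in> inscribed_lengths \<gamma> t"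
  using assms unfolding inscribed_lengths_def by blast

lemma zero_in_inscribed_lengths: "0 \<le> t \<Longrightarrow> 0 \<in> inscribed_lengths \<gamma> t"
  using inscribed_lengthsI[of 0 "\<lambda>_. 0" t \<gamma>] by (simp add: mono_on_def)

lemma inscribed_lengths_mono: "s \<le> t \<Longrightarrow> inscribed_lengths \<gamma> s \<subseteq> inscribed_lengths \<gamma> t"
  unfolding inscribed_lengths_def by fastforce

lemma sum_lessThan_add:
  fixes f :: "nat \<Rightarrow> 'b::comm_monoid_add"
  shows "sum f {..<m + k} = sum f {..<m} + (\<Sum>i<k. f (m + i))"
  by (induction k) (simp_all add: add.assoc)

lemma inscribed_lengths_append:
  fixes \<gamma> :: "real \<Rightarrow> 'a::metric_space"
  assumes a: "a \<in> inscribed_lengths \<gamma> s" and "0 \<le> s" "s \<le> t"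
    and e: "mono_on {..k} e" "e ` {..k} \<subseteq> {s..t}"
  shows "\<exists>b\<in>inscribed_lengths \<gamma> t. a + (\<Sum>i<k. dist (\<gamma> (e i)) (\<gamma> (e (Suc i)))) \<le> b"
proof -
  obtain m d where d: "mono_on {..m} d" "d ` {..m} \<subseteq> {0..s}"
    and a_eq: "a = (\<Sum>i<m. dist (\<gamma> (d i)) (\<gamma> (d (Suc i))))"
    using a unfolding inscribed_lengths_def by blast
  \<comment> \<open>The nodes of \<open>d\<close> come first, then those of \<open>e\<close>, which
    makes \<open>m + Suc k\<close> edges. The bridging edge from \<open>d m\<close> to
    \<open>e 0\<close> can only add length, hence the inequality in the conclusion.\<close>
  define c where "c i = (if i \<le> m then d i else e (i - Suc m))" for i
  have dm: "0 \<le> d i" "d i \<le> s" if "i \<le> m" for i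
    using d(2) that by auto
  have em: "s \<le> e i" "e i \<le> t" if "i \<le> k" for i
    using e(2) that by auto
  have "mono_on {..m + Suc k} c"
  proof (rule mono_onI)
    fix i j assume ij: "i \<in> {..m + Suc k}" "j \<in> {..m + Suc k}" "i \<le> j"
    consider "j \<le> m" | "i \<le> m" "m < j" | "m < i" by linarith
    then show "c i \<le> c j"
    proof cases
      case 1
      then show ?thesis using d(1) ij by (simp add: c_def mono_on_def)
    next
      case 2
      then have "d i \<le> s" "s \<le> e (j - Suc m)" using dm em ij by auto
      then show ?thesis using 2 by (simp add: c_def)
    next
      case 3
      then have "e (i - Suc m) \<le> e (j - Suc m)" using ij by (intro mono_onD[OF e(1)]) auto
      then show ?thesis using 3 ij by (simp add: c_def)
    qed
  qed
  moreover have "c ` {..m + Suc k} \<subseteq> {0..t}"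
  proof
    fix u assume "u \<in> c ` {..m + Suc k}"
    then obtain i where i: "i \<le> m + Suc k" "u = c i" by auto
    show "u \<in> {0..t}"
    proof (cases "i \<le> m")
      case True
      then show ?thesis using i dm[of i] \<open>s \<le> t\<close> by (simp add: c_def)
    next
      case False
      then have "s \<le> u" "u \<le> t" using i em[of "i - Suc m"] by (auto simp: c_def)
      then show ?thesis using \<open>0 \<le> s\<close> by simp
    qed
  qed
  ultimately have mem: "(\<Sum>i<m + Suc k. dist (\<gamma> (c i)) (\<gamma> (c (Suc i)))) \<in> inscribed_lengths \<gamma> t"
    by (rule inscribed_lengthsI)
  have "(\<Sum>i<m + Suc k. dist (\<gamma> (c i)) (\<gamma> (c (Suc i)))) =
      (\<Sum>i<m. dist (\<gamma> (c i)) (\<gamma> (c (Suc i)))) + (dist (\<gamma> (c m)) (\<gamma> (c (Suc m)))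
       + (\<Sum>i<k. dist (\<gamma> (c (m + Suc i))) (\<gamma> (c (Suc (m + Suc i))))))"
    unfolding sum_lessThan_add sum.lessThan_Suc_shift by simp
  moreover have "(\<Sum>i<m. dist (\<gamma> (c i)) (\<gamma> (c (Suc i)))) = a"
    unfolding a_eq c_def by (intro sum.cong) auto
  moreover have "(\<Sum>i<k. dist (\<gamma> (c (m + Suc i))) (\<gamma> (c (Suc (m + Suc i))))) =
      (\<Sum>i<k. dist (\<gamma> (e i)) (\<gamma> (e (Suc i))))"
    by (intro sum.cong) (auto simp: c_def)
  ultimately show ?thesis
    using mem by (intro bexI[OF _ mem]) simp
qed

lemma inscribed_le_length_up_to:
  assumes "rectifiable_path \<gamma>" "t \<le> 1" "a \<in> inscribed_lengths \<gamma> t"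
  shows "a \<le> length_up_to \<gamma> t"
  unfolding length_up_to_def using assms inscribed_lengths_mono[of t 1 \<gamma>]
  by (intro cSup_upper) (auto simp: rectifiable_path_def intro: bdd_above_mono)

text \<open>The second chain stays fixed while the supremum runs over chains on
  \<open>{0..s}\<close>. This superadditivity controls single chords as well as whole tails of a
  chain.\<close>

lemma length_up_to_add_le:
  fixes \<gamma> :: "real \<Rightarrow> 'a::metric_space"
  assumes "rectifiable_path \<gamma>" "0 \<le> s" "s \<le> t" "t \<le> 1"
    and "mono_on {..k} e" "e ` {..k} \<subseteq> {s..t}"
  shows "length_up_to \<gamma> s + (\<Sum>i<k. dist (\<gamma> (e i)) (\<gamma> (e (Suc i)))) \<le> length_up_to \<gamma> t"
proof -
  have "length_up_to \<gamma> s \<le> length_up_to \<gamma> t - (\<Sum>i<k. dist (\<gamma> (e i)) (\<gamma> (e (Suc i))))"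
    unfolding length_up_to_def[of \<gamma> s]
  proof (rule cSup_least)
    show "inscribed_lengths \<gamma> s \<noteq> {}"
      using zero_in_inscribed_lengths assms(2) by blast
    fix a assume "a \<in> inscribed_lengths \<gamma> s"
    then obtain b where "b \<in> inscribed_lengths \<gamma> t"
      and "a + (\<Sum>i<k. dist (\<gamma> (e i)) (\<gamma> (e (Suc i)))) \<le> b"
      using inscribed_lengths_append[OF _ assms(2,3,5,6), of a \<gamma>] by blast
    with inscribed_le_length_up_to[OF assms(1,4)]
    show "a \<le> length_up_to \<gamma> t - (\<Sum>i<k. dist (\<gamma> (e i)) (\<gamma> (e (Suc i))))"
      by force
  qed
  then show ?thesis by simp
qed

text \<open>A one-edge chain suffices. This domination of chords is what makes
  \<open>\<gamma>\<close> constant on the fibres of its length function and the arc-length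
  parametrisation 1-Lipschitz.\<close>

lemma dist_le_length_up_to_diff:
  fixes \<gamma> :: "real \<Rightarrow> 'a::metric_space"
  assumes "rectifiable_path \<gamma>" "0 \<le> s" "s \<le> t" "t \<le> 1"
  shows "dist (\<gamma> s) (\<gamma> t) \<le> length_up_to \<gamma> t - length_up_to \<gamma> s"
proof -
  have "mono_on {..1} (\<lambda>i::nat. if i = 0 then s else t)"
    using assms by (auto simp: mono_on_def)
  moreover have "(\<lambda>i::nat. if i = 0 then s else t) ` {..1} \<subseteq> {s..t}"
    using assms by auto
  ultimately show ?thesis
    using length_up_to_add_le[OF assms, of 1 "\<lambda>i. if i = 0 then s else t"] by simp
qed

lemma length_up_to_mono:
  fixes \<gamma> :: "real \<Rightarrow> 'a::metric_space"
  assumes "rectifiable_path \<gamma>" "0 \<le> s" "s \<le> t" "t \<le> 1"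
  shows "length_up_to \<gamma> s \<le> length_up_to \<gamma> t"
  using dist_le_length_up_to_diff[OF assms] zero_le_dist[of "\<gamma> s" "\<gamma> t"] by linarith

lemma length_up_to_0: "length_up_to \<gamma> 0 = 0"
proof -
  have "inscribed_lengths \<gamma> 0 = {0}"
  proof -
    have "a = 0" if a: "a \<in> inscribed_lengths \<gamma> 0" for a
    proof -
      obtain m d where "mono_on {..m} d" "d ` {..m} \<subseteq> {0..0::real}"
        and "a = (\<Sum>i<m. dist (\<gamma> (d i)) (\<gamma> (d (Suc i))))"
        using a unfolding inscribed_lengths_def by blast
      moreover from this have "d i = 0" if "i \<le> m" for i
        using that by (auto simp: image_subset_iff)
      ultimately show ?thesis by simp
    qed
    then show ?thesis using zero_in_inscribed_lengths[of 0 \<gamma>] by auto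
  qed
  then show ?thesis by (simp add: length_up_to_def)
qed

text \<open>
  Truncating an almost optimal chain at \<open>u\<close> approximates \<open>length_up_to \<gamma> u\<close> uniformly in \<open>u\<close>,
  and the length of the truncated chain depends continuously on \<open>u\<close>.
\<close>

lemma continuous_on_length_up_to:
  fixes \<gamma> :: "real \<Rightarrow> 'a::metric_space"
  assumes rect: "rectifiable_path \<gamma>"
  shows "continuous_on {0..1} (length_up_to \<gamma>)"
  unfolding continuous_on_iff
proof (intro ballI allI impI)
  fix x \<epsilon> :: real assume x: "x \<in> {0..1}" and "\<epsilon> > 0"
  have "\<exists>a\<in>inscribed_lengths \<gamma> 1. length_up_to \<gamma> 1 - \<epsilon> / 3 < a"
    using rect \<open>\<epsilon> > 0\<close> zero_in_inscribed_lengths[of 1 \<gamma>] unfolding length_up_to_def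
    by (subst less_cSup_iff[symmetric]) (auto simp: rectifiable_path_def)
  then obtain m d where d: "mono_on {..m} d" "d ` {..m} \<subseteq> {0..1}"
    and sum: "length_up_to \<gamma> 1 - \<epsilon> / 3 < (\<Sum>i<m. dist (\<gamma> (d i)) (\<gamma> (d (Suc i))))"
    unfolding inscribed_lengths_def by blast
  have dm: "0 \<le> d i" "d i \<le> 1" if "i \<le> m" for i
    using d(2) that by auto
  \<comment> \<open>\<open>V u\<close> is the chain cut off at \<open>u\<close>, \<open>W u\<close>
    its remainder. The remainder uses at most
    \<open>length_up_to \<gamma> 1 - length_up_to \<gamma> u\<close>, so \<open>V u\<close> misses
    at most \<open>\<epsilon> / 3\<close> of the length up to \<open>u\<close>.\<close>
  define V W where "V u = (\<Sum>i<m. dist (\<gamma> (min (d i) u)) (\<gamma> (min (d (Suc i)) u)))"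
    and "W u = (\<Sum>i<m. dist (\<gamma> (max (d i) u)) (\<gamma> (max (d (Suc i)) u)))" for u
  have approx: "\<bar>V u - length_up_to \<gamma> u\<bar> \<le> \<epsilon> / 3" if u: "u \<in> {0..1}" for u
  proof -
    have "(\<lambda>i. min (d i) u) ` {..m} \<subseteq> {0..u}"
      using dm u by auto
    moreover have "mono_on {..m} (\<lambda>i. min (d i) u)"
      using d(1) unfolding mono_on_def by (metis min.mono order_refl)
    ultimately have "V u \<in> inscribed_lengths \<gamma> u"
      unfolding V_def by (intro inscribed_lengthsI)
    then have 1: "V u \<le> length_up_to \<gamma> u"
      using inscribed_le_length_up_to rect u by auto
    have "(\<lambda>i. max (d i) u) ` {..m} \<subseteq> {u..1}"
      using dm u by auto
    moreover have "mono_on {..m} (\<lambda>i. max (d i) u)"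
      using d(1) unfolding mono_on_def by (metis max.mono order_refl)
    ultimately have 2: "length_up_to \<gamma> u + W u \<le> length_up_to \<gamma> 1"
      unfolding W_def using rect u by (intro length_up_to_add_le) auto
    \<comment> \<open>An edge on one side of \<open>u\<close> survives in one of the two sums; an
      edge across \<open>u\<close> is split at \<open>\<gamma> u\<close> by the triangle
      inequality.\<close>
    have "dist (\<gamma> (d i)) (\<gamma> (d (Suc i))) \<le> dist (\<gamma> (min (d i) u)) (\<gamma> (min (d (Suc i)) u))
        + dist (\<gamma> (max (d i) u)) (\<gamma> (max (d (Suc i)) u))" if "i < m" for i
    proof -
      have le: "d i \<le> d (Suc i)"
        using d(1) that by (auto simp: mono_on_def)
      consider "d (Suc i) \<le> u" | "u \<le> d i" | "d i \<le> u" "u \<le> d (Suc i)" by linarith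
      then show ?thesis
      proof cases
        case 3
        then show ?thesis by (simp add: dist_triangle max_absorb2 min_absorb2 max_absorb1)
      qed (use le in \<open>simp_all add: max_absorb1 min_absorb1\<close>)
    qed
    then have "(\<Sum>i<m. dist (\<gamma> (d i)) (\<gamma> (d (Suc i)))) \<le> V u + W u"
      unfolding V_def W_def sum.distrib[symmetric] by (intro sum_mono) auto
    with 1 2 sum show ?thesis by linarith
  qed
  have "continuous_on {0..1} (\<lambda>u. \<gamma> (min (d i) u))" if "i \<le> m" for i
  proof (rule continuous_on_compose2[of "{0..1}" \<gamma> "{0..1}" "min (d i)"])
    show "continuous_on {0..1} \<gamma>"
      using rect by (simp add: rectifiable_path_def path_def)
    show "continuous_on {0..1} (min (d i))"
      by (intro continuous_intros)
    show "min (d i) ` {0..1} \<subseteq> {0..1}"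
      using dm that by auto
  qed
  then have "continuous_on {0..1} V"
    unfolding V_def by (intro continuous_intros) auto
  then obtain \<delta> where "\<delta> > 0"
    and \<delta>: "\<And>y. y \<in> {0..1} \<Longrightarrow> dist y x < \<delta> \<Longrightarrow> dist (V y) (V x) < \<epsilon> / 3"
    using x \<open>\<epsilon> > 0\<close> unfolding continuous_on_iff by (metis divide_pos_pos zero_less_numeral)
  have "dist (length_up_to \<gamma> y) (length_up_to \<gamma> x) < \<epsilon>" if "y \<in> {0..1}" "dist y x < \<delta>" for y
    using \<delta>[OF that] approx[OF that(1)] approx[OF x] unfolding dist_real_def by linarith
  then show "\<exists>\<delta>>0. \<forall>y\<in>{0..1}. dist y x < \<delta> \<longrightarrow> dist (length_up_to \<gamma> y) (length_up_to \<gamma> x) < \<epsilon>"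
    using \<open>\<delta> > 0\<close> by blast
qed

section \<open>The arc-length parametrisation\<close>

lemma arc_length_param_length_up_to:
  fixes \<gamma> :: "real \<Rightarrow> 'a::metric_space"
  assumes "rectifiable_path \<gamma>" "t \<in> {0..1}"
  shows "arc_length_param \<gamma> (length_up_to \<gamma> t) = \<gamma> t"
proof -
  define s where "s = (SOME s. s \<in> {0..1} \<and> length_up_to \<gamma> s = length_up_to \<gamma> t)"
  have s: "s \<in> {0..1} \<and> length_up_to \<gamma> s = length_up_to \<gamma> t"
    unfolding s_def by (rule someI[of _ t]) (use assms in auto)
  \<comment> \<open>\<open>SOME\<close> may select a parameter other than \<open>t\<close>, but no
    length separates the two, so the chord vanishes.\<close>
  have "dist (\<gamma> s) (\<gamma> t) \<le> 0"
  proof (cases "s \<le> t")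
    case True
    then show ?thesis
      using dist_le_length_up_to_diff[OF assms(1), of s t] s assms(2) by simp
  next
    case False
    then show ?thesis
      using dist_le_length_up_to_diff[OF assms(1), of t s] s assms(2) by (simp add: dist_commute)
  qed
  then show ?thesis
    unfolding arc_length_param_def s_def by simp
qed

lemma length_up_to_surj:
  fixes \<gamma> :: "real \<Rightarrow> 'a::metric_space"
  assumes "rectifiable_path \<gamma>" "u \<in> {0..length_up_to \<gamma> 1}"
  obtains t where "t \<in> {0..1}" "length_up_to \<gamma> t = u"
proof -
  have "\<exists>t\<ge>0. t \<le> 1 \<and> length_up_to \<gamma> t = u"
    using continuous_on_length_up_to[OF assms(1)] assms(2)
    by (intro IVT') (simp_all add: length_up_to_0)
  then show thesis using that by auto
qed

lemma arc_length_param_in_path_image: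
  fixes \<gamma> :: "real \<Rightarrow> 'a::metric_space"
  assumes "rectifiable_path \<gamma>" "u \<in> {0..length_up_to \<gamma> 1}"
  shows "arc_length_param \<gamma> u \<in> path_image \<gamma>"
proof -
  obtain t where "t \<in> {0..1}" "length_up_to \<gamma> t = u"
    using length_up_to_surj[OF assms] .
  then show ?thesis
    using arc_length_param_length_up_to[OF assms(1)] unfolding path_image_def by blast
qed

lemma arc_length_param_ends:
  fixes \<gamma> :: "real \<Rightarrow> 'a::metric_space"
  assumes "rectifiable_path \<gamma>"
  shows "arc_length_param \<gamma> 0 = pathstart \<gamma>"
    and "arc_length_param \<gamma> (length_up_to \<gamma> 1) = pathfinish \<gamma>"
  using arc_length_param_length_up_to[OF assms, of 0] arc_length_param_length_up_to[OF assms, of 1]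
  by (simp_all add: length_up_to_0 pathstart_def pathfinish_def)

lemma arc_length_param_lipschitz:
  fixes \<gamma> :: "real \<Rightarrow> 'a::metric_space"
  assumes "rectifiable_path \<gamma>"
  shows "1-lipschitz_on {0..length_up_to \<gamma> 1} (arc_length_param \<gamma>)"
proof (rule lipschitz_onI)
  fix u v assume "u \<in> {0..length_up_to \<gamma> 1}" "v \<in> {0..length_up_to \<gamma> 1}"
  then obtain s t where st: "s \<in> {0..1}" "length_up_to \<gamma> s = u" "t \<in> {0..1}" "length_up_to \<gamma> t = v"
    using length_up_to_surj[OF assms] by metis
  then have eq: "arc_length_param \<gamma> u = \<gamma> s" "arc_length_param \<gamma> v = \<gamma> t"
    using arc_length_param_length_up_to[OF assms] by blast+
  show "dist (arc_length_param \<gamma> u) (arc_length_param \<gamma> v) \<le> 1 * dist u v"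
    using dist_le_length_up_to_diff[OF assms, of s t] dist_le_length_up_to_diff[OF assms, of t s] st
    unfolding eq by (cases "s \<le> t") (auto simp: dist_commute dist_real_def)
qed simp

section \<open>Lengths of Lipschitz paths and of segments\<close>

lemma lipschitz_inscribed_lengths_le:
  assumes L: "C-lipschitz_on {0..1} \<gamma>" and "t \<le> 1" and a: "a \<in> inscribed_lengths \<gamma> t"
  shows "a \<le> C * t"
proof -
  obtain m d where d: "mono_on {..m} d" "d ` {..m} \<subseteq> {0..t}"
    and a_eq: "a = (\<Sum>i<m. dist (\<gamma> (d i)) (\<gamma> (d (Suc i))))"
    using a unfolding inscribed_lengths_def by blast
  have dm: "0 \<le> d i" "d i \<le> t" if "i \<le> m" for i
    using d(2) that by auto
  have "dist (\<gamma> (d i)) (\<gamma> (d (Suc i))) \<le> C * (d (Suc i) - d i)" if "i < m" for i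
  proof -
    have "d i \<le> d (Suc i)"
      using d(1) that by (auto simp: mono_on_def)
    moreover have "dist (\<gamma> (d i)) (\<gamma> (d (Suc i))) \<le> C * dist (d i) (d (Suc i))"
      using dm[of i] dm[of "Suc i"] that \<open>t \<le> 1\<close> by (intro lipschitz_onD[OF L]) auto
    ultimately show ?thesis by (simp add: dist_real_def)
  qed
  then have "a \<le> (\<Sum>i<m. C * (d (Suc i) - d i))"
    unfolding a_eq by (intro sum_mono) auto
  also have "\<dots> = C * (d m - d 0)"
    by (simp add: sum_lessThan_telescope flip: sum_distrib_left)
  also have "\<dots> \<le> C * t"
    using lipschitz_on_nonneg[OF L] dm[of m] dm[of 0] by (intro mult_left_mono) auto
  finally show ?thesis .
qed

lemma lipschitz_rectifiable_path:
  assumes "C-lipschitz_on {0..1} \<gamma>"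
  shows "rectifiable_path \<gamma>"
  unfolding rectifiable_path_def path_def
  using lipschitz_on_continuous_on[OF assms] lipschitz_inscribed_lengths_le[OF assms order_refl]
  by (auto intro!: bdd_aboveI[of _ C])

lemma linepath_lipschitz: "(dist x y)-lipschitz_on {0..1} (linepath x y)"
proof (rule lipschitz_onI)
  fix s t :: real
  have "linepath x y s - linepath x y t = (t - s) *\<^sub>R (x - y)"
    by (simp add: linepath_def algebra_simps)
  then show "dist (linepath x y s) (linepath x y t) \<le> dist x y * dist s t"
    by (simp add: dist_norm dist_real_def abs_minus_commute mult.commute)
qed simp

lemma length_up_to_linepath:
  assumes "t \<in> {0..1}"
  shows "length_up_to (linepath x y) t = t * dist x y"
proof (rule antisym)
  have rect: "rectifiable_path (linepath x y)"
    using linepath_lipschitz by (rule lipschitz_rectifiable_path)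
  show "length_up_to (linepath x y) t \<le> t * dist x y"
    unfolding length_up_to_def
  proof (rule cSup_least)
    show "inscribed_lengths (linepath x y) t \<noteq> {}"
      using zero_in_inscribed_lengths assms by fastforce
    show "a \<le> t * dist x y" if "a \<in> inscribed_lengths (linepath x y) t" for a
      using lipschitz_inscribed_lengths_le[OF linepath_lipschitz _ that] assms
      by (simp add: mult.commute)
  qed
  have "linepath x y 0 - linepath x y t = t *\<^sub>R (x - y)"
    by (simp add: linepath_def algebra_simps)
  then have "dist (linepath x y 0) (linepath x y t) = t * dist x y"
    using assms by (simp add: dist_norm)
  then show "t * dist x y \<le> length_up_to (linepath x y) t"
    using dist_le_length_up_to_diff[OF rect, of 0 t] assms by (simp add: length_up_to_0)
qed

section \<open>The one-dimensional potential\<close>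

text \<open>The odd antiderivative of \<open>1 / (r - \<bar>s\<bar>)\<close>.\<close>

definition radial_potential :: "real \<Rightarrow> real \<Rightarrow> real" where
  "radial_potential r s = sgn s * ln (r / (r - \<bar>s\<bar>))"

lemma radial_potential_0 [simp]: "radial_potential r 0 = 0"
  by (simp add: radial_potential_def)

lemma radial_potential_minus: "radial_potential r (- s) = - radial_potential r s"
  by (simp add: radial_potential_def)

lemma radial_potential_nonneg:
  assumes "0 \<le> s" "s < r"
  shows "radial_potential r s = ln r - ln (r - s)"
  using assms by (cases "s = 0") (simp_all add: radial_potential_def ln_div)

lemma radial_potential_nonpos:
  assumes "s \<le> 0" "- r < s"
  shows "radial_potential r s = ln (r + s) - ln r"
  using radial_potential_nonneg[of "- s" r] assms by (simp add: radial_potential_minus)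

text \<open>The logarithmic formula differs on the two sides of 0, so the fundamental theorem is
  applied to each side and an interval containing 0 is split there.\<close>

lemma has_integral_radial_potential:
  assumes "- r < a" "a \<le> b" "b < r"
  shows "((\<lambda>s. 1 / (r - \<bar>s\<bar>)) has_integral radial_potential r b - radial_potential r a) {a..b}"
proof -
  have pos: "((\<lambda>s. 1 / (r - \<bar>s\<bar>)) has_integral radial_potential r d - radial_potential r c) {c..d}"
    if "0 \<le> c" "c \<le> d" "d < r" for c d
  proof (rule fundamental_theorem_of_calculus[OF \<open>c \<le> d\<close>])
    fix s assume s: "s \<in> {c..d}"
    have "((\<lambda>s. ln r - ln (r - s)) has_real_derivative 1 / (r - \<bar>s\<bar>)) (at s within {c..d})"
      using s that by (auto intro!: derivative_eq_intros simp: field_simps)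
    then show "(radial_potential r has_vector_derivative 1 / (r - \<bar>s\<bar>)) (at s within {c..d})"
      unfolding has_real_derivative_iff_has_vector_derivative
      by (rule has_vector_derivative_transform[rotated 2])
        (use s that in \<open>auto simp: radial_potential_nonneg\<close>)
  qed
  have neg: "((\<lambda>s. 1 / (r - \<bar>s\<bar>)) has_integral radial_potential r d - radial_potential r c) {c..d}"
    if "d \<le> 0" "c \<le> d" "- r < c" for c d
  proof (rule fundamental_theorem_of_calculus[OF \<open>c \<le> d\<close>])
    fix s assume s: "s \<in> {c..d}"
    have "((\<lambda>s. ln (r + s) - ln r) has_real_derivative 1 / (r - \<bar>s\<bar>)) (at s within {c..d})"
      using s that by (auto intro!: derivative_eq_intros simp: field_simps)
    then show "(radial_potential r has_vector_derivative 1 / (r - \<bar>s\<bar>)) (at s within {c..d})"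
      unfolding has_real_derivative_iff_has_vector_derivative
      by (rule has_vector_derivative_transform[rotated 2])
        (use s that in \<open>auto simp: radial_potential_nonpos\<close>)
  qed
  consider "0 \<le> a" | "b \<le> 0" | "a \<le> 0" "0 \<le> b" by linarith
  then show ?thesis
  proof cases
    case 3
    with has_integral_combine[OF 3 neg[of 0 a] pos[of 0 b]] assms show ?thesis by simp
  qed (use pos neg assms in auto)
qed

text \<open>The density is at most \<open>1 / (r - m)\<close> on \<open>{-m..m}\<close>. The
  absolute value on the right also covers \<open>b < a\<close>, where the left side is
  nonpositive.\<close>

lemma radial_potential_diff_le:
  assumes "\<bar>a\<bar> \<le> m" "\<bar>b\<bar> \<le> m" "m < r"
  shows "radial_potential r b - radial_potential r a \<le> \<bar>b - a\<bar> / (r - m)"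
proof -
  have le: "0 \<le> radial_potential r d - radial_potential r c"
    "radial_potential r d - radial_potential r c \<le> (d - c) / (r - m)"
    if "\<bar>c\<bar> \<le> m" "\<bar>d\<bar> \<le> m" "c \<le> d" for c d
  proof -
    have int: "((\<lambda>s. 1 / (r - \<bar>s\<bar>)) has_integral radial_potential r d - radial_potential r c) {c..d}"
      using that assms by (intro has_integral_radial_potential) auto
    show "0 \<le> radial_potential r d - radial_potential r c"
      using that assms by (intro has_integral_nonneg[OF int]) auto
    have "((\<lambda>_. 1 / (r - m)) has_integral (d - c) *\<^sub>R (1 / (r - m))) {c..d}"
      using has_integral_const_real[of "1 / (r - m)" c d] that by simp
    from has_integral_le[OF int this]
    show "radial_potential r d - radial_potential r c \<le> (d - c) / (r - m)"
      using that assms by (force intro!: divide_left_mono)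
  qed
  show ?thesis
  proof (cases "a \<le> b")
    case True
    then show ?thesis using le(2)[of a b] assms by simp
  next
    case False
    then have "radial_potential r b - radial_potential r a \<le> 0" using le(1)[of b a] assms by simp
    also have "\<dots> \<le> \<bar>b - a\<bar> / (r - m)" using assms by simp
    finally show ?thesis .
  qed
qed

text \<open>For smooth \<open>f\<close> this is the chain rule. For Lipschitz \<open>f\<close> the
  inequality is relaxed by an error proportional to the length of the interval; the relaxed form
  adds up over adjacent intervals and holds on short ones, so bisection (\<open>Bolzano\<close>)
  extends it to \<open>{0..l}\<close>.\<close>

lemma radial_potential_lipschitz_path:
  fixes f :: "real \<Rightarrow> real"
  assumes f: "1-lipschitz_on {0..l} f" and "0 \<le> l" and fr: "\<And>u. u \<in> {0..l} \<Longrightarrow> \<bar>f u\<bar> < r"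
  shows "radial_potential r (f l) - radial_potential r (f 0) \<le> integral {0..l} (\<lambda>u. 1 / (r - \<bar>f u\<bar>))"
proof (rule field_le_epsilon)
  define g where "g u = 1 / (r - \<bar>f u\<bar>)" for u
  have g: "continuous_on {0..l} g"
    unfolding g_def using fr
    by (intro continuous_intros lipschitz_on_continuous_on[OF f]) force
  then have int: "g integrable_on {u..v}" if "{u..v} \<subseteq> {0..l}" for u v
    using continuous_on_subset integrable_continuous_real that by blast
  fix \<epsilon> :: real assume "\<epsilon> > 0"
  \<comment> \<open>The total error will be \<open>2 * \<eta> * l\<close>; the denominator
    \<open>l + 1\<close> allows \<open>l = 0\<close>.\<close>
  define \<eta> where "\<eta> = \<epsilon> / (2 * (l + 1))"
  have "\<eta> > 0" using \<open>\<epsilon> > 0\<close> \<open>0 \<le> l\<close> by (simp add: \<eta>_def)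
  define P where "P u v \<longleftrightarrow> (0 \<le> u \<and> u \<le> v \<and> v \<le> l \<longrightarrow>
    radial_potential r (f v) - radial_potential r (f u) \<le> integral {u..v} g + 2 * \<eta> * (v - u))" for u v
  from \<open>0 \<le> l\<close> have "P 0 l"
  proof (induction rule: Bolzano)
    case (trans a b c)
    show ?case unfolding P_def
    proof (intro impI, elim conjE)
      assume "0 \<le> a" "a \<le> c" "c \<le> l"
      moreover from this have "integral {a..b} g + integral {b..c} g = integral {a..c} g"
        using trans int[of a c] by (intro Henstock_Kurzweil_Integration.integral_combine) auto
      ultimately show "radial_potential r (f c) - radial_potential r (f a)
          \<le> integral {a..c} g + 2 * \<eta> * (c - a)"
        using trans by (simp add: P_def algebra_simps)
    qed
  next
    case (local x)
    then obtain \<delta> where "\<delta> > 0" and \<delta>: "\<And>u. u \<in> {0..l} \<Longrightarrow> dist u x < \<delta> \<Longrightarrow> dist (g u) (g x) < \<eta>"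
      using g \<open>\<eta> > 0\<close> unfolding continuous_on_iff by (metis atLeastAtMost_iff)
    show ?case
    proof (intro exI conjI allI impI)
      fix a b assume ab: "a \<le> x \<and> x \<le> b \<and> b - a < \<delta>"
      show "P a b" unfolding P_def
      proof (intro impI, elim conjE)
        assume *: "0 \<le> a" "a \<le> b" "b \<le> l"
        have near: "g x - \<eta> \<le> g u" "g u \<le> g x + \<eta>" if "u \<in> {a..b}" for u
          using \<delta>[of u] that ab * by (auto simp: dist_real_def abs_less_iff)
        \<comment> \<open>At the endpoint with the larger \<open>\<bar>f\<bar>\<close>, the bound
          for the density between \<open>f a\<close> and \<open>f b\<close> is exactly
          \<open>g c\<close>, and this is close to \<open>g x\<close>.\<close>
        obtain c where c: "c \<in> {a, b}" "\<bar>f a\<bar> \<le> \<bar>f c\<bar>" "\<bar>f b\<bar> \<le> \<bar>f c\<bar>"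
          by (metis insert_iff linear order_refl)
        have "dist (f b) (f a) \<le> 1 * dist b a"
          using * by (intro lipschitz_onD[OF f]) auto
        then have fab: "\<bar>f b - f a\<bar> \<le> b - a"
          using * by (simp add: dist_real_def)
        have "\<bar>f c\<bar> < r" using fr[of c] c * by auto
        have "radial_potential r (f b) - radial_potential r (f a) \<le> \<bar>f b - f a\<bar> / (r - \<bar>f c\<bar>)"
          using c \<open>\<bar>f c\<bar> < r\<close> by (intro radial_potential_diff_le) auto
        also have "\<dots> \<le> (b - a) * g c"
          using fab \<open>\<bar>f c\<bar> < r\<close> by (simp add: g_def divide_right_mono)
        also have "\<dots> \<le> (b - a) * (g x + \<eta>)"
          using near(2)[of c] c * by (intro mult_left_mono) auto
        \<comment> \<open>The lower bound \<open>g x - \<eta>\<close> contributes the second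
          \<open>\<eta>\<close>, which explains the factor 2 in \<open>P\<close>.\<close>
        also have "(b - a) * (g x - \<eta>) \<le> integral {a..b} g"
          using has_integral_le[OF has_integral_const_real[of "g x - \<eta>" a b]
              integrable_integral[OF int]] near(1) * by auto
        then have "(b - a) * (g x + \<eta>) \<le> integral {a..b} g + 2 * \<eta> * (b - a)"
          by (simp add: algebra_simps)
        finally show "radial_potential r (f b) - radial_potential r (f a)
            \<le> integral {a..b} g + 2 * \<eta> * (b - a)" .
      qed
    qed fact
  qed
  then have "radial_potential r (f l) - radial_potential r (f 0) \<le> integral {0..l} g + 2 * \<eta> * l"
    using \<open>0 \<le> l\<close> by (simp add: P_def)
  moreover have "2 * \<eta> * l \<le> \<epsilon>"
    using \<open>\<epsilon> > 0\<close> \<open>0 \<le> l\<close> by (simp add: \<eta>_def field_simps)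
  ultimately show "radial_potential r (f l) - radial_potential r (f 0)
      \<le> integral {0..l} (\<lambda>u. 1 / (r - \<bar>f u\<bar>)) + \<epsilon>"
    unfolding g_def by linarith
qed

text \<open>The density is even and increases with \<open>\<bar>s\<bar>\<close>, so centring an interval at 0 minimises its weight.\<close>

lemma radial_potential_diff_ge:
  assumes "- r < a" "a \<le> b" "b < r"
  shows "2 * radial_potential r ((b - a) / 2) \<le> radial_potential r b - radial_potential r a"
proof -
  have r: "0 < r" "(b - a) / 2 < r" using assms by auto
  have pos: "2 * radial_potential r ((d - c) / 2) \<le> radial_potential r d - radial_potential r c"
    if "0 \<le> c" "c \<le> d" "d < r" for c d
  proof -
    \<comment> \<open>Exponentiated, the claim reads \<open>r\<^sup>2 * (r - d) \<le> (r - c) * (r -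
      (d - c) / 2)\<^sup>2\<close>; the identity writes the difference as a sum of nonnegative
      terms.\<close>
    have "(r - c) * (r - (d - c) / 2)\<^sup>2 - r\<^sup>2 * (r - d) = r * c * (d - c) + (r - c) * ((d - c) / 2)\<^sup>2"
      by (simp add: power2_eq_square field_simps)
    moreover have "0 \<le> r * c * (d - c) + (r - c) * ((d - c) / 2)\<^sup>2"
      using that by (intro add_nonneg_nonneg mult_nonneg_nonneg) auto
    ultimately have "r\<^sup>2 * (r - d) \<le> (r - c) * (r - (d - c) / 2)\<^sup>2"
      by linarith
    then have "ln (r\<^sup>2 * (r - d)) \<le> ln ((r - c) * (r - (d - c) / 2)\<^sup>2)"
      using that r by (intro ln_mono) auto
    then show ?thesis
      using that r by (simp add: radial_potential_nonneg ln_mult ln_realpow)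
  qed
  consider "0 \<le> a" | "b \<le> 0" | "a \<le> 0" "0 \<le> b" by linarith
  then show ?thesis
  proof cases
    case 1
    then show ?thesis using pos assms by simp
  next
    case 2
    then show ?thesis using pos[of "- b" "- a"] assms by (simp add: radial_potential_minus)
  next
    case 3
    \<comment> \<open>The arithmetic-geometric mean inequality for \<open>r + a\<close> and
      \<open>r - b\<close>, whose mean is \<open>r - (b - a) / 2\<close>.\<close>
    have "(r + a) * (r - b) \<le> (r - (b - a) / 2)\<^sup>2"
      using zero_le_power2[of "(a + b) / 2"] by (simp add: power2_eq_square field_simps)
    then have "ln ((r + a) * (r - b)) \<le> ln ((r - (b - a) / 2)\<^sup>2)"
      using assms by (intro ln_mono) auto
    then show ?thesis
      using 3 assms r
      by (simp add: radial_potential_nonneg radial_potential_nonpos ln_mult ln_realpow)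
  qed
qed

section \<open>Jung's theorem\<close>

text \<open>Compactness in the space of pairs of centre and radius: the cap
  \<open>\<rho> \<le> M\<close> makes the admissible set bounded, and an enclosing ball above the
  cap exceeds the minimal radius anyway.\<close>

lemma minimal_enclosing_ball:
  fixes K :: "'a::euclidean_space set"
  assumes "bounded K" "K \<noteq> {}"
  obtains c \<rho> where "K \<subseteq> cball c \<rho>" "\<And>c' \<rho>'. K \<subseteq> cball c' \<rho>' \<Longrightarrow> \<rho> \<le> \<rho>'"
proof -
  obtain k where "k \<in> K" using assms by blast
  obtain M where M: "K \<subseteq> cball k M"
    using \<open>bounded K\<close> bounded_any_center[of K k] by (auto simp: subset_eq)
  define S where "S = {(c, \<rho>). K \<subseteq> cball c \<rho> \<and> \<rho> \<le> M}"
  have "S = (\<Inter>x\<in>K. {p. dist (fst p) x \<le> snd p}) \<inter> {p. snd p \<le> M}"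
    by (auto simp: S_def)
  then have "closed S"
    by (auto intro!: closed_Int closed_INT closed_Collect_le continuous_intros)
  moreover have "S \<subseteq> cball k M \<times> {0..M}"
  proof safe
    fix c \<rho> assume "(c, \<rho>) \<in> S"
    then have "dist c k \<le> \<rho>" "\<rho> \<le> M" using \<open>k \<in> K\<close> by (auto simp: S_def)
    then show "c \<in> cball k M" "\<rho> \<in> {0..M}"
      using zero_le_dist[of c k] by (auto simp: dist_commute simp del: zero_le_dist)
  qed
  then have "bounded S"
    by (rule bounded_subset[rotated]) (simp add: bounded_Times)
  moreover have "(k, M) \<in> S" using M by (simp add: S_def)
  ultimately obtain p where p: "p \<in> S" "\<And>q. q \<in> S \<Longrightarrow> snd p \<le> snd q"
    using continuous_attains_inf[of S snd] continuous_on_snd[OF continuous_on_id, of S]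
      compact_eq_bounded_closed[of S] by blast
  show thesis
  proof
    show "K \<subseteq> cball (fst p) (snd p)" using p(1) by (auto simp: S_def)
    fix c' \<rho>' assume "K \<subseteq> cball c' \<rho>'"
    then show "snd p \<le> \<rho>'"
      using p(1) p(2)[of "(c', \<rho>')"] by (cases "\<rho>' \<le> M") (auto simp: S_def)
  qed
qed

text \<open>
  If the centre were outside the convex hull of the contact points, moving it towards the hull
  would decrease the radius.
\<close>

lemma minimal_enclosing_ball_center:
  fixes K :: "'a::euclidean_space set"
  assumes "compact K" "K \<noteq> {}" and K: "K \<subseteq> cball c \<rho>"
    and min: "\<And>c' \<rho>'. K \<subseteq> cball c' \<rho>' \<Longrightarrow> \<rho> \<le> \<rho>'"
  shows "c \<in> convex hull {x \<in> K. dist c x = \<rho>}"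
proof (rule ccontr)
  define T where "T = {x \<in> K. dist c x = \<rho>}"
  assume "c \<notin> convex hull {x \<in> K. dist c x = \<rho>}"
  then have c: "c \<notin> convex hull T" by (simp add: T_def)
  have "T = K \<inter> sphere c \<rho>" by (auto simp: T_def)
  then have "compact T" using \<open>compact K\<close> by (simp add: compact_Int_closed)
  then have closed: "closed (convex hull T)"
    by (simp add: compact_convex_hull compact_imp_closed)
  \<comment> \<open>\<open>v\<close> points from \<open>c\<close> to the nearest point of the hull,
    and the obtuse angle at that point gives the inequality. With no contact points any nonzero
    vector will do.\<close>
  obtain v where "v \<noteq> 0" and v: "\<And>x. x \<in> T \<Longrightarrow> (x - c) \<bullet> v \<ge> v \<bullet> v"
  proof (cases "T = {}")
    case True
    obtain b :: 'a where "b \<in> Basis" using nonempty_Basis by blast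
    then show ?thesis using that[of b] True nonzero_Basis by blast
  next
    case False
    define p where "p = closest_point (convex hull T) c"
    have "p \<in> convex hull T"
      unfolding p_def using closed False by (intro closest_point_in_set) auto
    then have "p - c \<noteq> 0" using c by auto
    moreover have "(x - c) \<bullet> (p - c) \<ge> (p - c) \<bullet> (p - c)" if "x \<in> T" for x
      using closest_point_dot[OF convex_convex_hull closed hull_inc[OF that], of c]
      unfolding p_def[symmetric] by (simp add: algebra_simps inner_commute)
    ultimately show ?thesis using that by blast
  qed
  have vv: "v \<bullet> v > 0" using \<open>v \<noteq> 0\<close> by simp
  \<comment> \<open>Points of \<open>A\<close> may recede from the moving centre, but no contact
    point lies in \<open>A\<close>, so by compactness their distances from \<open>c\<close> stay
    below some \<open>\<mu> < \<rho>\<close>.\<close>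
  define A where "A = K \<inter> {x. (x - c) \<bullet> v \<le> v \<bullet> v / 2}"
  have "compact A"
    unfolding A_def using \<open>compact K\<close>
    by (intro compact_Int_closed closed_Collect_le continuous_intros) auto
  have A_less: "dist c x < \<rho>" if "x \<in> A" for x
    using that K v[of x] vv by (force simp: A_def T_def)
  obtain \<mu> where "\<mu> < \<rho>" and \<mu>: "\<And>x. x \<in> A \<Longrightarrow> dist c x \<le> \<mu>"
  proof (cases "A = {}")
    case True
    then show ?thesis using that[of "\<rho> - 1"] by auto
  next
    case False
    have "continuous_on A (dist c)" by (intro continuous_intros)
    then obtain a where "a \<in> A" "\<And>x. x \<in> A \<Longrightarrow> dist c x \<le> dist c a"
      using continuous_attains_sup[OF \<open>compact A\<close> False] by blast
    then show ?thesis using that A_less by blast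
  qed
  \<comment> \<open>The second bound keeps \<open>A\<close> inside the sphere after the shift. The
    first lets the linear gain outside \<open>A\<close>, more than
    \<open>\<epsilon> * (v \<bullet> v)\<close> in the squared distance, absorb the quadratic
    term.\<close>
  define \<epsilon> where "\<epsilon> = min (1 / 2) ((\<rho> - \<mu>) / (2 * norm v))"
  have \<epsilon>: "0 < \<epsilon>" "\<epsilon> \<le> 1 / 2" "\<epsilon> * norm v < \<rho> - \<mu>"
  proof -
    show "0 < \<epsilon>" "\<epsilon> \<le> 1 / 2" using \<open>\<mu> < \<rho>\<close> \<open>v \<noteq> 0\<close> by (auto simp: \<epsilon>_def)
    have "\<epsilon> * norm v \<le> (\<rho> - \<mu>) / (2 * norm v) * norm v"
      unfolding \<epsilon>_def by (intro mult_right_mono) auto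
    also have "\<dots> < \<rho> - \<mu>" using \<open>\<mu> < \<rho>\<close> \<open>v \<noteq> 0\<close> by simp
    finally show "\<epsilon> * norm v < \<rho> - \<mu>" .
  qed
  have less: "dist (c + \<epsilon> *\<^sub>R v) x < \<rho>" if "x \<in> K" for x
  proof (cases "x \<in> A")
    case True
    have "dist (c + \<epsilon> *\<^sub>R v) x \<le> dist (c + \<epsilon> *\<^sub>R v) c + dist c x" by (rule dist_triangle)
    also have "\<dots> \<le> \<epsilon> * norm v + \<mu>" using \<mu>[OF True] \<epsilon> by (simp add: dist_norm)
    finally show ?thesis using \<epsilon> by linarith
  next
    case False
    have "(norm (x - (c + \<epsilon> *\<^sub>R v)))\<^sup>2
        = (norm (x - c))\<^sup>2 - 2 * \<epsilon> * ((x - c) \<bullet> v) + \<epsilon> * \<epsilon> * (v \<bullet> v)"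
      by (simp add: power2_norm_eq_inner algebra_simps inner_commute)
    also have "\<dots> < (norm (x - c))\<^sup>2 - \<epsilon> * (v \<bullet> v) + \<epsilon> * \<epsilon> * (v \<bullet> v)"
      using False that \<epsilon>(1) by (simp add: A_def)
    also have "\<dots> \<le> (norm (x - c))\<^sup>2"
      using \<epsilon> vv by (simp add: mult_left_le_one_le)
    finally have "norm (x - (c + \<epsilon> *\<^sub>R v)) < norm (x - c)"
      by (rule power_less_imp_less_base) simp
    also have "\<dots> \<le> \<rho>" using that K by (auto simp: dist_norm norm_minus_commute)
    finally show ?thesis by (simp add: dist_norm norm_minus_commute)
  qed
  \<comment> \<open>Compactness turns the pointwise strict bound into an enclosing ball of smaller
    radius.\<close>
  have "continuous_on K (dist (c + \<epsilon> *\<^sub>R v))" by (intro continuous_intros)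
  then obtain a where "a \<in> K" "\<And>x. x \<in> K \<Longrightarrow> dist (c + \<epsilon> *\<^sub>R v) x \<le> dist (c + \<epsilon> *\<^sub>R v) a"
    using continuous_attains_sup[OF \<open>compact K\<close> \<open>K \<noteq> {}\<close>] by blast
  then have "K \<subseteq> cball (c + \<epsilon> *\<^sub>R v) (dist (c + \<epsilon> *\<^sub>R v) a)"
    by (simp add: subset_eq)
  from min[OF this] less[OF \<open>a \<in> K\<close>] show False by simp
qed

text \<open>With the weights that represent the centre, the mean squared distance from a contact
  point to the chosen contact points is twice the squared radius. Bounding these distances by the
  diameter and summing over the points yields the constant.\<close>

theorem Jung:
  fixes S :: "'a::euclidean_space set"
  assumes "bounded S"
  obtains c where "S \<subseteq> cball c (sqrt (real DIM('a) / (2 * real DIM('a) + 2)) * diameter S)"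
proof (cases "S = {}")
  case False
  define K where "K = closure S"
  have K: "compact K" "K \<noteq> {}" "bounded K"
    using assms False by (auto simp: K_def bounded_closure compact_closure)
  obtain c \<rho> where c: "K \<subseteq> cball c \<rho>" and min: "\<And>c' \<rho>'. K \<subseteq> cball c' \<rho>' \<Longrightarrow> \<rho> \<le> \<rho>'"
    using minimal_enclosing_ball[OF K(3,2)] by metis
  have "c \<in> convex hull {x \<in> K. dist c x = \<rho>}"
    using K c min by (intro minimal_enclosing_ball_center) auto
  then obtain F where F: "finite F" "F \<subseteq> {x \<in> K. dist c x = \<rho>}" "card F \<le> DIM('a) + 1"
    and "c \<in> convex hull F"
    using caratheodory[of "{x \<in> K. dist c x = \<rho>}"] by auto
  then obtain u where u: "\<And>x. x \<in> F \<Longrightarrow> 0 \<le> u x" "sum u F = 1" "(\<Sum>x\<in>F. u x *\<^sub>R x) = c"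
    by (auto simp: convex_hull_finite)
  define D where "D = diameter S"
  define m where "m = card F"
  have norm_c: "(norm (x - c))\<^sup>2 = \<rho>\<^sup>2" if "x \<in> F" for x
    using F(2) that by (auto simp: dist_norm norm_minus_commute)
  have centred: "(\<Sum>x\<in>F. u x *\<^sub>R (x - c)) = 0"
  proof -
    have "(\<Sum>x\<in>F. u x *\<^sub>R (x - c)) = (\<Sum>x\<in>F. u x *\<^sub>R x) - sum u F *\<^sub>R c"
      by (simp add: scaleR_diff_right sum_subtractf scaleR_sum_left)
    then show ?thesis using u by simp
  qed
  have bound: "2 * \<rho>\<^sup>2 \<le> (1 - u y) * D\<^sup>2" if y: "y \<in> F" for y
  proof -
    have "(norm (x - y))\<^sup>2 = 2 * \<rho>\<^sup>2 - 2 * ((x - c) \<bullet> (y - c))" if "x \<in> F" for x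
    proof -
      have "(norm (x - y))\<^sup>2 = (norm (x - c))\<^sup>2 + (norm (y - c))\<^sup>2 - 2 * ((x - c) \<bullet> (y - c))"
        by (simp add: power2_norm_eq_inner algebra_simps inner_commute)
      then show ?thesis using norm_c that y by simp
    qed
    then have "(\<Sum>x\<in>F. u x * (norm (x - y))\<^sup>2)
        = (\<Sum>x\<in>F. u x * (2 * \<rho>\<^sup>2) - 2 * ((u x *\<^sub>R (x - c)) \<bullet> (y - c)))"
      by (intro sum.cong) (simp_all add: right_diff_distrib)
    also have "\<dots> = 2 * \<rho>\<^sup>2 - 2 * ((\<Sum>x\<in>F. u x *\<^sub>R (x - c)) \<bullet> (y - c))"
      unfolding sum_subtractf sum_distrib_right[symmetric] u(2)
      by (simp add: inner_sum_left sum_distrib_left)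
    also have "\<dots> = 2 * \<rho>\<^sup>2" by (simp add: centred)
    finally have "2 * \<rho>\<^sup>2 = (\<Sum>x\<in>F. u x * (norm (x - y))\<^sup>2)" by simp
    \<comment> \<open>The vanishing summand at \<open>y\<close> saves the weight \<open>u y\<close>;
      this saving makes the constant sharp.\<close>
    also have "\<dots> = (\<Sum>x\<in>F - {y}. u x * (norm (x - y))\<^sup>2)"
      using sum.remove[OF F(1) y, of "\<lambda>x. u x * (norm (x - y))\<^sup>2"] by simp
    also have "\<dots> \<le> (\<Sum>x\<in>F - {y}. u x * D\<^sup>2)"
    proof (intro sum_mono mult_left_mono power_mono)
      fix x assume "x \<in> F - {y}"
      then have "x \<in> K" "y \<in> K" using F(2) y by auto
      then show "norm (x - y) \<le> D"
        using diameter_bounded_bound[OF K(3)] diameter_closure[OF assms]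
        by (simp add: D_def K_def dist_norm)
    qed (use u in auto)
    also have "\<dots> = (1 - u y) * D\<^sup>2"
      using sum.remove[OF F(1) y, of u] u(2) by (simp flip: sum_distrib_right)
    finally show ?thesis .
  qed
  \<comment> \<open>Summation over \<open>y\<close> replaces the unknown weights by their sum
    1.\<close>
  have "real m * (2 * \<rho>\<^sup>2) \<le> (\<Sum>y\<in>F. (1 - u y) * D\<^sup>2)"
    unfolding m_def using bound by (intro sum_bounded_below)
  also have "\<dots> = (real m - 1) * D\<^sup>2"
    unfolding m_def sum_distrib_right[symmetric] by (simp add: sum_subtractf u(2))
  finally have "real m * (2 * \<rho>\<^sup>2) \<le> (real m - 1) * D\<^sup>2" .
  moreover have "m > 0"
    using u(2) F(1) by (auto simp: m_def card_gt_0_iff)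
  ultimately have "2 * \<rho>\<^sup>2 \<le> (1 - 1 / real m) * D\<^sup>2"
    by (simp add: field_simps)
  \<comment> \<open>\<open>1 - 1 / m\<close> grows with \<open>m\<close>, so the extreme case has n
    + 1 contact points, as for a regular simplex.\<close>
  also have "\<dots> \<le> (1 - 1 / (real DIM('a) + 1)) * D\<^sup>2"
    using F(3) \<open>m > 0\<close> unfolding m_def
    by (intro mult_right_mono diff_left_mono divide_left_mono) auto
  finally have "\<rho>\<^sup>2 \<le> real DIM('a) / (2 * real DIM('a) + 2) * D\<^sup>2"
    by (simp add: field_simps)
  then have "\<rho> \<le> sqrt (real DIM('a) / (2 * real DIM('a) + 2) * D\<^sup>2)"
    by (rule real_le_rsqrt)
  also have "\<dots> = sqrt (real DIM('a) / (2 * real DIM('a) + 2)) * D"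
    unfolding real_sqrt_mult using diameter_ge_0[OF assms] by (simp add: D_def)
  finally have "\<rho> \<le> sqrt (real DIM('a) / (2 * real DIM('a) + 2)) * D" .
  then have "S \<subseteq> cball c (sqrt (real DIM('a) / (2 * real DIM('a) + 2)) * D)"
    using c closure_subset[of S] by (force simp: K_def)
  then show ?thesis using that D_def by blast
qed (use that in auto)

section \<open>Bounds for the quasihyperbolic metric\<close>

text \<open>The zero vector gets an arbitrary direction, so coinciding points need no separate
  treatment later.\<close>

lemma obtain_direction:
  fixes v :: "'a::euclidean_space"
  obtains e where "norm e = 1" "v = norm v *\<^sub>R e"
proof (cases "v = 0")
  case True
  obtain b :: 'a where "b \<in> Basis" using nonempty_Basis by blast
  then show ?thesis using that[of b] True by simp
next
  case False
  then show ?thesis using that[of "v /\<^sub>R norm v"] by simp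
qed

section \<open>Distance to the boundary\<close>

lemma boundary_dist_le:
  fixes G :: "'a::euclidean_space set"
  assumes "x \<in> G" "G \<subseteq> ball z r"
  shows "boundary_dist G x \<le> r - dist z x"
proof -
  obtain e where e: "norm e = 1" "x - z = norm (x - z) *\<^sub>R e"
    by (rule obtain_direction)
  \<comment> \<open>The ray from \<open>z\<close> through \<open>x\<close> leaves the ball at
    \<open>p\<close>, outside \<open>G\<close>, so the segment from \<open>x\<close> to
    \<open>p\<close> meets the frontier.\<close>
  define p where "p = z + r *\<^sub>R e"
  have r: "dist z x < r" using assms by auto
  then have "0 < r" using zero_le_dist[of z x] by linarith
  then have "dist z p = r" using e(1) by (simp add: p_def dist_norm)
  then have "p \<notin> G" using assms(2) by auto
  have "p - x = (r - norm (x - z)) *\<^sub>R e"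
    using e(2) by (simp add: p_def algebra_simps)
  then have xp: "dist x p = r - dist z x"
    using e(1) r by (simp add: dist_norm norm_minus_commute)
  have "closed_segment x p \<inter> frontier G \<noteq> {}"
    using assms(1) \<open>p \<notin> G\<close> by (intro connected_Int_frontier connected_segment) auto
  then obtain q where q: "q \<in> closed_segment x p" "q \<in> frontier G" by blast
  have "infdist x (frontier G) \<le> dist x q" using q(2) by (rule infdist_le)
  also have "\<dots> \<le> dist x p" using dist_in_closed_segment[OF q(1)] by (simp add: dist_commute)
  finally show ?thesis by (simp add: boundary_dist_def xp)
qed

lemma boundary_dist_ball:
  fixes z :: "'a::euclidean_space"
  assumes "x \<in> ball z r"
  shows "boundary_dist (ball z r) x = r - dist z x"
proof (rule antisym)
  show "boundary_dist (ball z r) x \<le> r - dist z x"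
    using assms by (intro boundary_dist_le) auto
  have "0 < r" using assms by (metis ball_eq_empty empty_iff not_le)
  have "ball z r \<noteq> UNIV"
    using bounded_ball[of z r] not_bounded_UNIV[where 'a = 'a] by metis
  then have ne: "frontier (ball z r) \<noteq> {}"
    unfolding frontier_eq_empty using assms by blast
  have "r - dist z x \<le> dist x y" if "y \<in> sphere z r" for y
    using that dist_triangle[of z y x] by simp
  then show "r - dist z x \<le> boundary_dist (ball z r) x"
    unfolding boundary_dist_def infdist_notempty[OF ne]
    using ne \<open>0 < r\<close> by (intro cINF_greatest) auto
qed

text \<open>Boundedness rules out \<open>G = UNIV\<close>, whose empty frontier would give
  \<open>infdist\<close> its default value 0. Positivity keeps the density free of division by
  zero.\<close>

lemma boundary_dist_pos:
  assumes "open G" "bounded G" "x \<in> G"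
  shows "0 < boundary_dist G x"
  unfolding boundary_dist_def
proof (rule infdist_pos_not_in_closed)
  show "frontier G \<noteq> {}"
    using assms not_bounded_UNIV[where 'a = 'a] by (auto simp: frontier_eq_empty)
  show "x \<notin> frontier G" using assms by (simp add: frontier_def interior_open)
qed simp

section \<open>Lower bounds by projection to a line\<close>

lemma arc_length_integral_ge:
  fixes G :: "'a::euclidean_space set"
  assumes "open G" "G \<subseteq> ball z r" and \<gamma>: "rectifiable_path \<gamma>" "path_image \<gamma> \<subseteq> G"
    and "norm e = 1"
  shows "radial_potential r (e \<bullet> (pathfinish \<gamma> - z)) - radial_potential r (e \<bullet> (pathstart \<gamma> - z))
    \<le> arc_length_integral \<gamma> (\<lambda>x. 1 / boundary_dist G x)"
proof -
  define l where "l = length_up_to \<gamma> 1"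
  define p where "p = arc_length_param \<gamma>"
  \<comment> \<open>Projection to a unit direction does not increase distances: \<open>f\<close>
    inherits the Lipschitz constant 1, and \<open>r - \<bar>f u\<bar>\<close> is at least the
    boundary distance at \<open>p u\<close>.\<close>
  define f where "f u = e \<bullet> (p u - z)" for u
  have "0 \<le> l"
    using length_up_to_mono[OF \<gamma>(1), of 0 1] by (simp add: l_def length_up_to_0)
  have pG: "p u \<in> G" if "u \<in> {0..l}" for u
    using arc_length_param_in_path_image[OF \<gamma>(1)] that \<gamma>(2) by (auto simp: p_def l_def)
  have lip: "1-lipschitz_on {0..l} p"
    unfolding p_def l_def using \<gamma>(1) by (rule arc_length_param_lipschitz)
  have f_le: "\<bar>f u\<bar> \<le> dist z (p u)" for u
    using Cauchy_Schwarz_ineq2[of e "p u - z"] \<open>norm e = 1\<close>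
    by (simp add: f_def dist_norm norm_minus_commute)
  have fr: "\<bar>f u\<bar> < r" if "u \<in> {0..l}" for u
    using f_le[of u] pG[OF that] assms(2) by auto
  have f_lip: "1-lipschitz_on {0..l} f"
  proof (rule lipschitz_onI)
    fix u v assume "u \<in> {0..l}" "v \<in> {0..l}"
    then have "norm (p u - p v) \<le> dist u v"
      using lipschitz_onD[OF lip, of u v] by (simp add: dist_norm)
    moreover have "f u - f v = e \<bullet> (p u - p v)"
      by (simp add: f_def inner_diff_right)
    ultimately show "dist (f u) (f v) \<le> 1 * dist u v"
      using Cauchy_Schwarz_ineq2[of e "p u - p v"] \<open>norm e = 1\<close> by (simp add: dist_real_def)
  qed simp
  have "bounded G" using assms(2) by (rule bounded_subset_ballI)
  then have pos: "0 < boundary_dist G (p u)" if "u \<in> {0..l}" for u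
    using boundary_dist_pos \<open>open G\<close> pG[OF that] by blast
  have "radial_potential r (f l) - radial_potential r (f 0) \<le> integral {0..l} (\<lambda>u. 1 / (r - \<bar>f u\<bar>))"
    using f_lip \<open>0 \<le> l\<close> fr by (rule radial_potential_lipschitz_path)
  also have "\<dots> \<le> integral {0..l} (\<lambda>u. 1 / boundary_dist G (p u))"
  proof (rule integral_le)
    show "(\<lambda>u. 1 / (r - \<bar>f u\<bar>)) integrable_on {0..l}"
      using fr by (intro integrable_continuous_real continuous_intros
        lipschitz_on_continuous_on[OF f_lip]) force
    have "continuous_on {0..l} (\<lambda>u. boundary_dist G (p u))"
      unfolding boundary_dist_def by (intro continuous_intros lipschitz_on_continuous_on[OF lip])
    then show "(\<lambda>u. 1 / boundary_dist G (p u)) integrable_on {0..l}"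
      using pos by (intro integrable_continuous_real continuous_intros) force+
    fix u assume u: "u \<in> {0..l}"
    have "boundary_dist G (p u) \<le> r - dist z (p u)"
      using pG[OF u] assms(2) by (rule boundary_dist_le)
    then have "boundary_dist G (p u) \<le> r - \<bar>f u\<bar>"
      using f_le[of u] by linarith
    then show "1 / (r - \<bar>f u\<bar>) \<le> 1 / boundary_dist G (p u)"
      using pos[OF u] by (intro divide_left_mono) auto
  qed
  finally show ?thesis
    unfolding arc_length_integral_def f_def p_def l_def arc_length_param_ends[OF \<gamma>(1)] .
qed

text \<open>A polynomial path has bounded derivative on the unit interval, hence is Lipschitz. Its
  existence ensures that the infimum in \<open>qh_metric\<close> is not over the empty set.\<close>

lemma connected_open_rectifiable_path:
  fixes G :: "'a::euclidean_space set"
  assumes "open G" "connected G" "x \<in> G" "y \<in> G"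
  obtains \<gamma> where "rectifiable_path \<gamma>" "path_image \<gamma> \<subseteq> G" "pathstart \<gamma> = x" "pathfinish \<gamma> = y"
proof -
  obtain \<gamma> where poly: "polynomial_function \<gamma>"
    and \<gamma>: "path_image \<gamma> \<subseteq> G" "pathstart \<gamma> = x" "pathfinish \<gamma> = y"
    using connected_open_polynomial_connected[OF assms] by blast
  obtain \<gamma>' where poly': "polynomial_function \<gamma>'"
    and deriv: "\<And>t. (\<gamma> has_vector_derivative \<gamma>' t) (at t)"
    using has_vector_derivative_polynomial_function[OF poly] by blast
  have "bounded (\<gamma>' ` {0..1})"
    by (intro compact_imp_bounded compact_continuous_image continuous_on_polymonial_function poly') auto
  then obtain C where C: "0 < C" "\<And>t. t \<in> {0..1} \<Longrightarrow> norm (\<gamma>' t) \<le> C"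
    by (auto simp: bounded_pos)
  have "C-lipschitz_on {0..1} \<gamma>"
  proof (rule bounded_derivative_imp_lipschitz)
    fix t :: real assume t: "t \<in> {0..1}"
    show "(\<gamma> has_derivative (\<lambda>s. s *\<^sub>R \<gamma>' t)) (at t within {0..1})"
      using deriv[of t] has_derivative_at_withinI unfolding has_vector_derivative_def by blast
    show "onorm (\<lambda>s. s *\<^sub>R \<gamma>' t) \<le> C"
      using C(2)[OF t] by (intro onorm_le) (simp add: mult.commute[of C] mult_left_mono)
  qed (use C in auto)
  then show thesis using that \<gamma> lipschitz_rectifiable_path by blast
qed

lemma qh_metric_ge_projection:
  fixes G :: "'a::euclidean_space set"
  assumes "open G" "connected G" "G \<subseteq> ball z r" "x \<in> G" "y \<in> G" "norm e = 1"
  shows "radial_potential r (e \<bullet> (y - z)) - radial_potential r (e \<bullet> (x - z)) \<le> qh_metric G x y"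
  unfolding qh_metric_def
proof (rule cInf_greatest, goal_cases)
  case 1
  obtain \<gamma> where "rectifiable_path \<gamma>" "path_image \<gamma> \<subseteq> G" "pathstart \<gamma> = x" "pathfinish \<gamma> = y"
    using connected_open_rectifiable_path assms(1,2,4,5) .
  then show ?case by blast
next
  case (2 k)
  then show ?case using arc_length_integral_ge[OF assms(1,3) _ _ assms(6)] by blast
qed

lemma qh_metric_ge_dist:
  fixes G :: "'a::euclidean_space set"
  assumes "open G" "connected G" "G \<subseteq> ball z r" "x \<in> G" "y \<in> G"
  shows "2 * radial_potential r (dist x y / 2) \<le> qh_metric G x y"
proof -
  obtain e where e: "norm e = 1" "y - x = norm (y - x) *\<^sub>R e"
    by (rule obtain_direction)
  \<comment> \<open>In the direction of \<open>y - x\<close> the projection preserves the distance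
    of the endpoints; the interval \<open>{a..b}\<close> need not be centred at 0.\<close>
  define a b where "a = e \<bullet> (x - z)" and "b = e \<bullet> (y - z)"
  have "b - a = e \<bullet> (y - x)"
    by (simp add: a_def b_def inner_diff_right)
  also have "\<dots> = norm (y - x) * (e \<bullet> e)"
    using e(2) by (metis inner_scaleR_right)
  also have "\<dots> = dist x y"
    using e(1) by (simp add: dot_square_norm dist_norm norm_minus_commute)
  finally have ba: "b - a = dist x y" .
  have abs: "\<bar>e \<bullet> (w - z)\<bar> < r" if "w \<in> G" for w
    using Cauchy_Schwarz_ineq2[of e "w - z"] e(1) assms(3) that
    by (force simp: dist_norm norm_minus_commute)
  have "- r < a" "b < r"
    using abs[OF assms(4)] abs[OF assms(5)] by (auto simp: a_def b_def)
  moreover have "a \<le> b" using ba zero_le_dist[of x y] by linarith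
  ultimately have "2 * radial_potential r ((b - a) / 2) \<le> radial_potential r b - radial_potential r a"
    by (intro radial_potential_diff_ge)
  also have "\<dots> \<le> qh_metric G x y"
    unfolding a_def b_def using assms e(1) by (rule qh_metric_ge_projection)
  finally show ?thesis by (simp add: ba)
qed

section \<open>Exact values on diameters of a ball\<close>

lemma qh_metric_ball_radial:
  fixes z :: "'a::euclidean_space"
  assumes "norm e = 1" "- r < a" "a \<le> b" "b < r"
  shows "qh_metric (ball z r) (z + a *\<^sub>R e) (z + b *\<^sub>R e) = radial_potential r b - radial_potential r a"
    (is "qh_metric ?B ?x ?y = _")
proof (rule antisym)
  have ball: "z + s *\<^sub>R e \<in> ?B" if "- r < s" "s < r" for s
    using that assms(1) by (simp add: dist_norm)
  have xy: "?x \<in> ?B" "?y \<in> ?B" using assms ball by auto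
  have proj: "e \<bullet> (z + s *\<^sub>R e - z) = s" for s
    using assms(1) by (simp add: dot_square_norm)
  show "radial_potential r b - radial_potential r a \<le> qh_metric ?B ?x ?y"
    using qh_metric_ge_projection[OF open_ball connected_ball order_refl xy assms(1)]
    by (simp only: proj)
  \<comment> \<open>On a diameter the projection loses nothing and the boundary distance is exactly
    \<open>r - \<bar>s\<bar>\<close>, so this segment attains the lower bound.\<close>
  define \<gamma> where "\<gamma> = linepath ?x ?y"
  have \<gamma>: "rectifiable_path \<gamma>" "path_image \<gamma> \<subseteq> ?B" "pathstart \<gamma> = ?x" "pathfinish \<gamma> = ?y"
    unfolding \<gamma>_def using xy
    by (auto simp: closed_segment_subset intro: lipschitz_rectifiable_path[OF linepath_lipschitz])
  have "?x - ?y = (a - b) *\<^sub>R e" by (simp add: algebra_simps)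
  then have dist: "dist ?x ?y = b - a"
    using assms by (simp add: dist_norm)
  have len: "length_up_to \<gamma> t = t * (b - a)" if "t \<in> {0..1}" for t
    using length_up_to_linepath[OF that, of ?x ?y] by (simp only: \<gamma>_def dist)
  \<comment> \<open>Expressed through \<open>t * (b - a) = u\<close>, the formula also covers
    \<open>a = b\<close>, where \<open>t\<close> is not determined by \<open>u\<close>.\<close>
  have param: "arc_length_param \<gamma> u = z + (u + a) *\<^sub>R e" if u: "u \<in> {0..b - a}" for u
  proof -
    have "u \<in> {0..length_up_to \<gamma> 1}" using u by (simp add: len)
    then obtain t where t: "t \<in> {0..1}" "length_up_to \<gamma> t = u"
      using length_up_to_surj[OF \<gamma>(1)] by blast
    then have "arc_length_param \<gamma> u = \<gamma> t"
      using arc_length_param_length_up_to[OF \<gamma>(1)] by blast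
    also have "\<dots> = z + (t * (b - a) + a) *\<^sub>R e"
      by (simp add: \<gamma>_def linepath_def algebra_simps)
    finally show ?thesis using t len by simp
  qed
  have "((\<lambda>u. 1 / (r - \<bar>u + a\<bar>)) has_integral radial_potential r b - radial_potential r a) {0..b - a}"
    using has_integral_shift_real_ivl[OF has_integral_radial_potential[OF assms(2-4)], of a] by simp
  then have "((\<lambda>u. 1 / boundary_dist ?B (arc_length_param \<gamma> u)) has_integral
      radial_potential r b - radial_potential r a) {0..b - a}"
  proof (rule has_integral_eq[rotated])
    fix u assume u: "u \<in> {0..b - a}"
    have "z + (u + a) *\<^sub>R e \<in> ?B" using u assms by (intro ball) auto
    from boundary_dist_ball[OF this]
    show "1 / (r - \<bar>u + a\<bar>) = 1 / boundary_dist ?B (arc_length_param \<gamma> u)"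
      using assms(1) by (simp add: param[OF u] dist_norm)
  qed
  then have "arc_length_integral \<gamma> (\<lambda>x. 1 / boundary_dist ?B x)
      = radial_potential r b - radial_potential r a"
    by (simp add: arc_length_integral_def len integral_unique)
  moreover have "qh_metric ?B ?x ?y \<le> arc_length_integral \<gamma> (\<lambda>x. 1 / boundary_dist ?B x)"
    unfolding qh_metric_def
  \<comment> \<open>A real \<open>Inf\<close> is known to be a lower bound only for sets bounded
    below; the projection estimate supplies the bound for all competing paths.\<close>
  proof (rule cInf_lower)
    show "bdd_below {arc_length_integral \<gamma> (\<lambda>x. 1 / boundary_dist ?B x) |\<gamma>. rectifiable_path \<gamma> \<and>
        path_image \<gamma> \<subseteq> ?B \<and> pathstart \<gamma> = ?x \<and> pathfinish \<gamma> = ?y}"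
    proof (rule bdd_belowI, elim CollectE exE conjE)
      fix k \<beta>
      assume "k = arc_length_integral \<beta> (\<lambda>x. 1 / boundary_dist ?B x)"
        and \<beta>: "rectifiable_path \<beta>" "path_image \<beta> \<subseteq> ?B" "pathstart \<beta> = ?x" "pathfinish \<beta> = ?y"
      with arc_length_integral_ge[OF open_ball order_refl \<beta>(1,2) assms(1)]
      show "radial_potential r b - radial_potential r a \<le> k"
        unfolding \<beta>(3,4) proj by simp
    qed
    show "arc_length_integral \<gamma> (\<lambda>x. 1 / boundary_dist ?B x) \<in>
        {arc_length_integral \<gamma> (\<lambda>x. 1 / boundary_dist ?B x) |\<gamma>. rectifiable_path \<gamma> \<and>
        path_image \<gamma> \<subseteq> ?B \<and> pathstart \<gamma> = ?x \<and> pathfinish \<gamma> = ?y}"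
      by (intro CollectI exI[of _ \<gamma>] conjI refl \<gamma>)
  qed
  ultimately show "qh_metric ?B ?x ?y \<le> radial_potential r b - radial_potential r a" by simp
qed

section \<open>Logarithmic form of the bound and the modulus of continuity\<close>

lemma two_radial_potential_half:
  assumes "0 \<le> d" "d < 2 * r"
  shows "2 * radial_potential r (d / 2) = 2 * ln (2 / (2 - d / r))"
proof -
  have "r / (r - d / 2) = 2 / (2 - d / r)" using assms by (simp add: field_simps)
  then show ?thesis
    using assms by (cases "d = 0") (simp_all add: radial_potential_def)
qed

text \<open>The strict bound by \<open>2 * r\<close> keeps \<open>2 - norm (x - y) / r\<close>
  positive, as the logarithm and its inversion require.\<close>

lemma qh_metric_ge_ln:
  fixes G :: "'a::euclidean_space set"
  assumes "open G" "connected G" "G \<subseteq> ball z r" "x \<in> G" "y \<in> G"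
  shows "2 * ln (2 / (2 - norm (x - y) / r)) \<le> qh_metric G x y"
    and "norm (x - y) < 2 * r"
proof -
  have "dist z x < r" "dist z y < r" using assms by auto
  then show less: "norm (x - y) < 2 * r"
    using dist_triangle2[of x y z] by (simp add: dist_norm norm_minus_commute)
  show "2 * ln (2 / (2 - norm (x - y) / r)) \<le> qh_metric G x y"
    using qh_metric_ge_dist[OF assms] two_radial_potential_half[OF norm_ge_zero less]
    by (simp add: dist_norm)
qed

text \<open>Seen from the midpoint, the segment is already the centred interval, so the recentring
  step of the lower bound is an equality.\<close>

lemma qh_metric_ball_midpoint:
  fixes x y :: "'a::euclidean_space"
  assumes "x \<in> ball (midpoint x y) r"
  shows "qh_metric (ball (midpoint x y) r) x y = 2 * ln (2 / (2 - norm (x - y) / r))"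
proof -
  define d z where "d = norm (x - y)" and "z = midpoint x y"
  obtain e where e: "norm e = 1" "y - x = norm (y - x) *\<^sub>R e"
    by (rule obtain_direction)
  have d: "0 \<le> d" "d / 2 < r"
    using assms dist_midpoint(3)[of x y] by (auto simp: d_def simp flip: dist_norm)
  have x: "x = z + (- (d / 2)) *\<^sub>R e" and y: "y = z + (d / 2) *\<^sub>R e"
  proof -
    have h: "(d / 2) *\<^sub>R e = (1 / 2) *\<^sub>R (y - x)"
      unfolding d_def norm_minus_commute[of x y] by (subst e(2)) simp
    have "(x + y) - (y - x) = 2 *\<^sub>R x" "(x + y) + (y - x) = 2 *\<^sub>R y"
      by (simp_all add: scaleR_2)
    moreover have "z - (d / 2) *\<^sub>R e = (1 / 2) *\<^sub>R ((x + y) - (y - x))"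
      "z + (d / 2) *\<^sub>R e = (1 / 2) *\<^sub>R ((x + y) + (y - x))"
      unfolding h z_def midpoint_def scaleR_diff_right[of _ "x + y"] scaleR_add_right[of _ "x + y"]
      by simp_all
    ultimately show "x = z + (- (d / 2)) *\<^sub>R e" "y = z + (d / 2) *\<^sub>R e"
      by simp_all
  qed
  have "qh_metric (ball z r) x y = radial_potential r (d / 2) - radial_potential r (- (d / 2))"
    unfolding x y using d e(1) by (intro qh_metric_ball_radial) auto
  also have "\<dots> = 2 * ln (2 / (2 - d / r))"
    using two_radial_potential_half[of d r] d by (simp add: radial_potential_minus)
  finally show ?thesis by (simp add: d_def z_def)
qed

text \<open>This is \<open>ln (1 - s) \<le> - s\<close> at \<open>s = t / 2\<close>.\<close>

lemma two_ln_ge: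
  fixes t :: real
  assumes "0 \<le> t" "t < 2"
  shows "t \<le> 2 * ln (2 / (2 - t))"
  using ln_one_minus_pos_upper_bound[of "t / 2"] ln_div[of 2 "2 - t"] ln_div[of "2 - t" 2] assms
  by (simp add: field_simps)

text \<open>Solving \<open>k = 2 * ln (2 / (2 - d / r))\<close> for \<open>d\<close> produces the
  modulus of continuity.\<close>

lemma modulus_of_two_ln:
  fixes d r :: real
  assumes "0 \<le> d" "d < 2 * r"
  shows "2 * r * (1 - exp (- (2 * ln (2 / (2 - d / r))) / 2)) = d"
proof -
  have "0 < r" "0 < 2 - d / r" using assms by (auto simp: field_simps)
  then have "exp (- ln (2 / (2 - d / r))) = (2 - d / r) / 2"
    by (simp add: exp_minus)
  then show ?thesis using \<open>0 < r\<close> by (simp add: field_simps)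
qed

text \<open>The modulus increases with \<open>k\<close>, so a lower bound for \<open>k\<close>
  becomes an upper bound for \<open>d\<close>.\<close>

lemma norm_le_modulus:
  fixes d r k :: real
  assumes "0 \<le> d" "d < 2 * r" "2 * ln (2 / (2 - d / r)) \<le> k"
  shows "d \<le> 2 * r * (1 - exp (- k / 2))"
proof -
  have "d = 2 * r * (1 - exp (- (2 * ln (2 / (2 - d / r))) / 2))"
    using modulus_of_two_ln[OF assms(1,2)] by simp
  also have "\<dots> \<le> 2 * r * (1 - exp (- k / 2))"
    using assms by (intro mult_left_mono) auto
  finally show ?thesis .
qed

text \<open>Any coordinate \<open>i\<close> can serve as the direction of the first unit vector. A
  ball of radius \<open>r\<close> has diameter \<open>2 * r\<close>, which matches the Jung radius
  only in dimension 1; the last conjunct therefore states the equality for balls of every positive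
  radius.\<close>

theorem theorem3p3:
  fixes i :: "'n::finite"
  shows
    "(let B = ball (0 :: real ^ 'n) 1; k = qh_metric B; \<omega> = (\<lambda>t::real. 2 * (1 - exp (- t / 2))) in
        (\<forall>x\<in>B. \<forall>y\<in>B. \<forall>w. w = (norm (x - y) / 2) *\<^sub>R axis i 1 \<longrightarrow>
            k x y \<ge> k (- w) w
          \<and> k (- w) w = 2 * k 0 w
          \<and> 2 * k 0 w = 2 * ln (2 / (2 - norm (x - y)))
          \<and> 2 * ln (2 / (2 - norm (x - y))) \<ge> norm (x - y)
          \<and> (y = - x \<longrightarrow> k x y = k (- w) w))
      \<and> (\<forall>x\<in>B. \<forall>y\<in>B. norm (x - y) \<le> \<omega> (k x y))
      \<and> (\<forall>t\<ge>0. \<exists>x\<in>B. \<exists>y\<in>B. k x y = t \<and> norm (x - y) = \<omega> t))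
   \<and> (\<forall>(G :: (real ^ 'n) set) r.
        proper_domain G \<and> bounded G
        \<and> r = sqrt (real CARD('n) / (2 * real CARD('n) + 2)) * diameter G \<longrightarrow>
        (let k = qh_metric G; \<omega> = (\<lambda>t::real. 2 * r * (1 - exp (- t / 2))) in
          (\<forall>x\<in>G. \<forall>y\<in>G. \<forall>t. x \<noteq> y \<and> t = norm (x - y) / r \<longrightarrow>
              k x y \<ge> 2 * ln (2 / (2 - t))
            \<and> 2 * ln (2 / (2 - t)) \<ge> t
            \<and> (\<forall>z. G = ball z r \<and> z = midpoint x y \<longrightarrow> k x y = 2 * ln (2 / (2 - t))))
        \<and> (\<forall>x\<in>G. \<forall>y\<in>G.
              norm (x - y) \<le> \<omega> (k x y)
            \<and> (\<forall>z. G = ball z r \<and> z = midpoint x y \<longrightarrow> norm (x - y) = \<omega> (k x y)))))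
   \<and> (\<forall>(z :: real ^ 'n) r. r > 0 \<longrightarrow>
        (let G = ball z r; k = qh_metric G; \<omega> = (\<lambda>t::real. 2 * r * (1 - exp (- t / 2))) in
          (\<forall>x\<in>G. \<forall>y\<in>G. z = midpoint x y \<longrightarrow>
              k x y = 2 * ln (2 / (2 - norm (x - y) / r))
            \<and> norm (x - y) = \<omega> (k x y))))"
proof (intro conjI)
  have axis: "norm (axis i 1 :: real ^ 'n) = 1" by simp
  \<comment> \<open>General \<open>a\<close> and \<open>b\<close> cover both pairs of the chain,
    \<open>(- w, w)\<close> and \<open>(0, w)\<close>.\<close>
  have unit: "qh_metric (ball (0 :: real ^ 'n) 1) (a *\<^sub>R axis i 1) (b *\<^sub>R axis i 1)
      = radial_potential 1 b - radial_potential 1 a" if "- 1 < a" "a \<le> b" "b < 1" for a b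
    using qh_metric_ball_radial[OF axis that, of 0] by simp
  have symm: "qh_metric (ball (0 :: real ^ 'n) 1) (- ((d / 2) *\<^sub>R axis i 1)) ((d / 2) *\<^sub>R axis i 1)
      = 2 * ln (2 / (2 - d))" if "0 \<le> d" "d < 2" for d
    using unit[of "- (d / 2)" "d / 2"] two_radial_potential_half[of d 1] that
    by (simp add: radial_potential_minus)
  have half: "2 * qh_metric (ball (0 :: real ^ 'n) 1) 0 ((d / 2) *\<^sub>R axis i 1) = 2 * ln (2 / (2 - d))"
    if "0 \<le> d" "d < 2" for d
    using unit[of 0 "d / 2"] two_radial_potential_half[of d 1] that by simp
  have ge: "2 * ln (2 / (2 - norm (x - y))) \<le> qh_metric (ball 0 1) x y" "norm (x - y) < 2"
    if "x \<in> ball 0 1" "y \<in> ball 0 1" for x y :: "real ^ 'n"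
    using qh_metric_ge_ln[OF open_ball connected_ball order_refl that] by simp_all
  show "let B = ball (0 :: real ^ 'n) 1; k = qh_metric B; \<omega> = (\<lambda>t::real. 2 * (1 - exp (- t / 2))) in
        (\<forall>x\<in>B. \<forall>y\<in>B. \<forall>w. w = (norm (x - y) / 2) *\<^sub>R axis i 1 \<longrightarrow>
            k x y \<ge> k (- w) w
          \<and> k (- w) w = 2 * k 0 w
          \<and> 2 * k 0 w = 2 * ln (2 / (2 - norm (x - y)))
          \<and> 2 * ln (2 / (2 - norm (x - y))) \<ge> norm (x - y)
          \<and> (y = - x \<longrightarrow> k x y = k (- w) w))
      \<and> (\<forall>x\<in>B. \<forall>y\<in>B. norm (x - y) \<le> \<omega> (k x y))
      \<and> (\<forall>t\<ge>0. \<exists>x\<in>B. \<exists>y\<in>B. k x y = t \<and> norm (x - y) = \<omega> t)"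
    unfolding Let_def
  proof (intro conjI ballI allI impI)
    fix x y w :: "real ^ 'n"
    assume x: "x \<in> ball 0 1" and y: "y \<in> ball 0 1" and w: "w = (norm (x - y) / 2) *\<^sub>R axis i 1"
    note xy = ge[OF x y]
    show "qh_metric (ball 0 1) (- w) w \<le> qh_metric (ball 0 1) x y"
      and "qh_metric (ball 0 1) (- w) w = 2 * qh_metric (ball 0 1) 0 w"
      and "2 * qh_metric (ball 0 1) 0 w = 2 * ln (2 / (2 - norm (x - y)))"
      unfolding w symm[OF norm_ge_zero xy(2)] half[OF norm_ge_zero xy(2)] using xy(1) by auto
    show "norm (x - y) \<le> 2 * ln (2 / (2 - norm (x - y)))"
      using xy(2) by (intro two_ln_ge) auto
    assume "y = - x"
    then have "midpoint x y = 0" by (simp add: midpoint_def)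
    then show "qh_metric (ball 0 1) x y = qh_metric (ball 0 1) (- w) w"
      unfolding w symm[OF norm_ge_zero xy(2)] using qh_metric_ball_midpoint[of x y 1] x by simp
  next
    fix x y :: "real ^ 'n"
    assume "x \<in> ball 0 1" "y \<in> ball 0 1"
    from ge[OF this] show "norm (x - y) \<le> 2 * (1 - exp (- qh_metric (ball 0 1) x y / 2))"
      using norm_le_modulus[of "norm (x - y)" 1] by simp
  next
    fix t :: real assume "0 \<le> t"
    \<comment> \<open>The points \<open>- w\<close> and \<open>w\<close> have distance
      \<open>2 * s\<close>, and \<open>s\<close> solves
      \<open>2 * ln (2 / (2 - 2 * s)) = t\<close>.\<close>
    define s where "s = 1 - exp (- t / 2)"
    define w :: "real ^ 'n" where "w = s *\<^sub>R axis i 1"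
    have s: "0 \<le> s" "s < 1" using \<open>0 \<le> t\<close> by (auto simp: s_def)
    have "2 - 2 * s = 2 * exp (- t / 2)" by (simp add: s_def)
    then have "2 / (2 - 2 * s) = exp (t / 2)"
      by (simp add: exp_minus inverse_eq_divide)
    then have "2 * ln (2 / (2 - 2 * s)) = t"
      by simp
    then have "qh_metric (ball 0 1) (- w) w = t"
      using symm[of "2 * s"] s by (simp add: w_def)
    moreover have "norm (- w - w) = 2 * (1 - exp (- t / 2))"
    proof -
      have "- w - w = (- 2 * s) *\<^sub>R axis i 1"
        unfolding w_def scaleR_minus_left[symmetric] scaleR_diff_left[symmetric] by simp
      then show ?thesis using s by (simp add: s_def)
    qed
    moreover have "w \<in> ball 0 1" "- w \<in> ball 0 1" using s by (auto simp: w_def)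
    ultimately show "\<exists>x\<in>ball 0 1. \<exists>y\<in>ball (0 :: real ^ 'n) 1. qh_metric (ball 0 1) x y = t
        \<and> norm (x - y) = 2 * (1 - exp (- t / 2))" by blast
  qed
next
  show "\<forall>(G :: (real ^ 'n) set) r.
        proper_domain G \<and> bounded G
        \<and> r = sqrt (real CARD('n) / (2 * real CARD('n) + 2)) * diameter G \<longrightarrow>
        (let k = qh_metric G; \<omega> = (\<lambda>t::real. 2 * r * (1 - exp (- t / 2))) in
          (\<forall>x\<in>G. \<forall>y\<in>G. \<forall>t. x \<noteq> y \<and> t = norm (x - y) / r \<longrightarrow>
              k x y \<ge> 2 * ln (2 / (2 - t))
            \<and> 2 * ln (2 / (2 - t)) \<ge> t
            \<and> (\<forall>z. G = ball z r \<and> z = midpoint x y \<longrightarrow> k x y = 2 * ln (2 / (2 - t))))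
        \<and> (\<forall>x\<in>G. \<forall>y\<in>G.
              norm (x - y) \<le> \<omega> (k x y)
            \<and> (\<forall>z. G = ball z r \<and> z = midpoint x y \<longrightarrow> norm (x - y) = \<omega> (k x y))))"
  proof (intro allI impI, elim conjE)
    fix G :: "(real ^ 'n) set" and r :: real
    assume G: "proper_domain G" "bounded G"
      and r: "r = sqrt (real CARD('n) / (2 * real CARD('n) + 2)) * diameter G"
    have oc: "open G" "connected G" using G(1) by (auto simp: proper_domain_def)
    obtain c where "G \<subseteq> cball c r"
      using Jung[OF G(2)] unfolding r by auto
    \<comment> \<open>Jung's ball is closed, but an open set inside it lies in its interior.\<close>
    then have sub: "G \<subseteq> ball c r"
      using interior_maximal[OF _ oc(1)] by (metis interior_cball)
    note ge = qh_metric_ge_ln[OF oc sub]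
    show "let k = qh_metric G; \<omega> = (\<lambda>t::real. 2 * r * (1 - exp (- t / 2))) in
          (\<forall>x\<in>G. \<forall>y\<in>G. \<forall>t. x \<noteq> y \<and> t = norm (x - y) / r \<longrightarrow>
              k x y \<ge> 2 * ln (2 / (2 - t))
            \<and> 2 * ln (2 / (2 - t)) \<ge> t
            \<and> (\<forall>z. G = ball z r \<and> z = midpoint x y \<longrightarrow> k x y = 2 * ln (2 / (2 - t))))
        \<and> (\<forall>x\<in>G. \<forall>y\<in>G.
              norm (x - y) \<le> \<omega> (k x y)
            \<and> (\<forall>z. G = ball z r \<and> z = midpoint x y \<longrightarrow> norm (x - y) = \<omega> (k x y)))"
      unfolding Let_def
    proof (intro conjI ballI allI impI; (elim conjE)?)
      fix x y t assume x: "x \<in> G" and y: "y \<in> G" and t: "t = norm (x - y) / r"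
      show "2 * ln (2 / (2 - t)) \<le> qh_metric G x y"
        unfolding t using ge(1)[OF x y] .
      have "0 < r" using ge(2)[OF x y] norm_ge_zero[of "x - y"] by linarith
      then show "t \<le> 2 * ln (2 / (2 - t))"
        using ge(2)[OF x y] by (intro two_ln_ge) (simp_all add: t field_simps)
      show "qh_metric G x y = 2 * ln (2 / (2 - t))" if "G = ball z r" "z = midpoint x y" for z
        unfolding t that(1) unfolding that(2)
        using x that by (intro qh_metric_ball_midpoint) blast
    next
      fix x y assume x: "x \<in> G" and y: "y \<in> G"
      show "norm (x - y) \<le> 2 * r * (1 - exp (- qh_metric G x y / 2))"
        using ge[OF x y] by (intro norm_le_modulus) auto
      show "norm (x - y) = 2 * r * (1 - exp (- qh_metric G x y / 2))"
        if "G = ball z r" "z = midpoint x y" for z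
      proof -
        have "qh_metric G x y = 2 * ln (2 / (2 - norm (x - y) / r))"
          unfolding that(1) unfolding that(2)
          using x that by (intro qh_metric_ball_midpoint) blast
        then show ?thesis using modulus_of_two_ln[OF norm_ge_zero ge(2)[OF x y]] by simp
      qed
    qed
  qed
next
  show "\<forall>(z :: real ^ 'n) r. r > 0 \<longrightarrow>
        (let G = ball z r; k = qh_metric G; \<omega> = (\<lambda>t::real. 2 * r * (1 - exp (- t / 2))) in
          (\<forall>x\<in>G. \<forall>y\<in>G. z = midpoint x y \<longrightarrow>
              k x y = 2 * ln (2 / (2 - norm (x - y) / r))
            \<and> norm (x - y) = \<omega> (k x y)))"
    unfolding Let_def
  proof (intro allI impI ballI)
    fix x y z :: "real ^ 'n" and r :: real
    assume x: "x \<in> ball z r" and y: "y \<in> ball z r" and z: "z = midpoint x y"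
    have eq: "qh_metric (ball z r) x y = 2 * ln (2 / (2 - norm (x - y) / r))"
      using x unfolding z by (rule qh_metric_ball_midpoint)
    have less: "norm (x - y) < 2 * r"
      using qh_metric_ge_ln(2)[OF open_ball connected_ball order_refl x y] .
    show "qh_metric (ball z r) x y = 2 * ln (2 / (2 - norm (x - y) / r))
        \<and> norm (x - y) = 2 * r * (1 - exp (- qh_metric (ball z r) x y / 2))"
      using eq modulus_of_two_ln[OF norm_ge_zero less] by simp
  qed
qed

end
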